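(* Let $X_1,X_2,Y_1,Y_2$ be non-negative random variables with distributions $F_1,F_2,G_1,G_2$ respectively, all from the class $\mathcal{D}$. Assume that $(X_k,Y_l)\in\mathcal{D}^{(2)}$ for all $k,l\in\{1,2\}$. Then $(X_1+X_2,\,Y_1+Y_2)\in\mathcal{D}^{(2)}$.
   Context: For a distribution $F$, $\overline F=1-F$, and all distributions satisfy $\overline F(x)>0$ for all $x\ge 0$; $x\wedge y=\min\{x,y\}$. $F\in\mathcal{D}$ (dominatedly varying) if $\limsup_{x\to\infty}\overline F(bx)/\overline F(x)<\infty$ for some (equivalently all) $b\in(0,1)$. A random pair $(X,Y)$ with marginal distributions $F,G$ belongs to $\mathcal{D}^{(2)}$ if $F\in\mathcal{D}$, $G\in\mathcal{D}$ and $\limsup_{x\wedge y\to\infty}\mathbf{P}[X>b_1x,Y>b_2y]/\mathbf{P}[X>x,Y>y]<\infty$ for some (equivalently all) $(b_1,b_2)\in(0,1)^2$ (the joint tail in the denominator is implicitly positive). No independence or other dependence assumption is made among the variables. *)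

theory Defs
  imports "HOL-Probability.Probability"
begin

text \<open>A distribution on the real line is represented by its Borel probability measure.\<close>

definition tail :: "real measure \<Rightarrow> real \<Rightarrow> real" where
  "tail F x = 1 - cdf F x"

text \<open>Dominatedly varying distributions. The standing convention that the tail of a distribution
  is positive on the non-negative half-line is part of the definition, so that the quotient never
  has the form \<open>a / 0\<close> (which is \<open>0\<close> in HOL). The limit superior is taken in the extended reals.\<close>

definition class_D :: "real measure set" where
  "class_D = {F. real_distribution F \<and> (\<forall>x\<ge>0. tail F x > 0) \<and>
     (\<exists>b\<in>{0<..<1}. Limsup at_top (\<lambda>x. ereal (tail F (b * x) / tail F x)) < \<infinity>)}"

definition joint_tail :: "'a measure \<Rightarrow> ('a \<Rightarrow> real) \<Rightarrow> ('a \<Rightarrow> real) \<Rightarrow> real \<Rightarrow> real \<Rightarrow> real" where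
  "joint_tail M X Y x y = measure M {\<omega> \<in> space M. X \<omega> > x \<and> Y \<omega> > y}"

text \<open>The filter on pairs \<open>(x, y)\<close> expressing that the minimum of \<open>x\<close> and \<open>y\<close> tends to infinity;
  the two coordinates may grow at unrelated rates.\<close>

definition min_at_top :: "(real \<times> real) filter" where
  "min_at_top = filtercomap (\<lambda>(x, y). min x y) at_top"

text \<open>As for the marginals, positivity of the joint tail in the denominator is made explicit.
  Since the joint tail is non-increasing in each argument, requiring it for all non-negative
  arguments is the same as requiring it for all sufficiently large ones.\<close>

definition class_D2 :: "'a measure \<Rightarrow> (('a \<Rightarrow> real) \<times> ('a \<Rightarrow> real)) set" where
  "class_D2 M = {(X, Y).
     X \<in> borel_measurable M \<and> Y \<in> borel_measurable M \<and>
     distr M borel X \<in> class_D \<and> distr M borel Y \<in> class_D \<and>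
     (\<forall>x\<ge>0. \<forall>y\<ge>0. joint_tail M X Y x y > 0) \<and>
     (\<exists>b1\<in>{0<..<1}. \<exists>b2\<in>{0<..<1}.
        Limsup min_at_top
          (\<lambda>(x, y). ereal (joint_tail M X Y (b1 * x) (b2 * y) / joint_tail M X Y x y)) < \<infinity>)}"

end

theory Submission
  imports Defs
begin

text \<open>
  Two facts carry the proof. First, if a non-increasing function of two variables grows by at most
  a constant factor when its arguments are shrunk by \<open>(b\<^sub>1, b\<^sub>2)\<close>, then iterating the bound shows the
  same for shrinking by any fixed factor; so the choice of \<open>(b\<^sub>1, b\<^sub>2)\<close> is immaterial
  (\<open>dilation_bounded_iterate\<close>).

  Second, by the pigeonhole principle a sum of two numbers exceeds \<open>x\<close> only if one summand exceeds
  \<open>x / 2\<close>, and for non-negative summands the sum exceeds \<open>x\<close> as soon as one summand does. Hence, writing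
  \<open>T\<close> for the joint tail of the sums and \<open>T\<^sub>k\<^sub>l\<close> for that of \<open>(X\<^sub>k, Y\<^sub>l)\<close>,
  \[ T\,(a x)\,(a y) \le \sum_{k,l} T_{kl}\,(a x/2)\,(a y/2) \le \sum_{k,l} C_{kl}\,T_{kl}\,x\,y
     \le \Bigl(\sum_{k,l} C_{kl}\Bigr)\,T\,x\,y \]
  for large \<open>x\<close> and \<open>y\<close>, where the middle step is dominated variation with the factor \<open>a/2\<close>
  (\<open>dilation_bounded_sandwich\<close>). The first step is the union bound, which holds under any dependence
  between the variables. The same computation with two terms instead of four handles the marginals.
\<close>

section \<open>Bounded growth under dilation\<close>

text \<open>A function of two variables is used even for one-dimensional tails, which are regarded as
  constant in \<open>y\<close>; marginals and joint tails then share all the analytic arguments.\<close>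

definition dilation_bounded :: "(real \<Rightarrow> real \<Rightarrow> real) \<Rightarrow> bool" where
  "dilation_bounded T \<longleftrightarrow>
     (\<forall>a>0. \<exists>C N. \<forall>x\<ge>N. \<forall>y\<ge>N. T (a * x) (a * y) \<le> C * T x y)"

text \<open>Applying the bound \<open>n\<close> times replaces \<open>b\<^sub>i\<close> by \<open>b\<^sub>i ^ n\<close>, which eventually drops below any
  \<open>a > 0\<close>; monotonicity then gives the bound for \<open>a\<close> itself.\<close>

lemma dilation_bounded_iterate:
  fixes T :: "real \<Rightarrow> real \<Rightarrow> real"
  assumes nonneg: "\<And>x y. 0 \<le> T x y"
    and anti: "\<And>x x' y y'. x \<le> x' \<Longrightarrow> y \<le> y' \<Longrightarrow> T x' y' \<le> T x y"
    and b1: "0 < b1" "b1 < 1" and b2: "0 < b2" "b2 < 1"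
    and step: "\<And>x y. N \<le> x \<Longrightarrow> N \<le> y \<Longrightarrow> T (b1 * x) (b2 * y) \<le> C * T x y"
  shows "dilation_bounded T"
  unfolding dilation_bounded_def
proof (intro allI impI)
  fix a :: real
  assume a: "0 < a"
  \<comment> \<open>A non-negative constant, so that the bounds can be multiplied in the induction.\<close>
  define D where "D = max C 0"
  have D: "0 \<le> D" by (simp add: D_def)
  have stepD: "T (b1 * x) (b2 * y) \<le> D * T x y" if "N \<le> x" "N \<le> y" for x y
    using step[OF that] mult_right_mono[OF _ nonneg, of C D x y] by (simp add: D_def)
  have iter: "\<exists>K. \<forall>x\<ge>K. \<forall>y\<ge>K. T (b1 ^ n * x) (b2 ^ n * y) \<le> D ^ n * T x y" for n
  proof (induction n)
    case 0
    then show ?case by simp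
  next
    case (Suc n)
    then obtain K where K: "\<And>x y. K \<le> x \<Longrightarrow> K \<le> y \<Longrightarrow>
        T (b1 ^ n * x) (b2 ^ n * y) \<le> D ^ n * T x y" by blast
    \<comment> \<open>Large enough for the induction hypothesis at \<open>(x, y)\<close> and for \<open>step\<close> at the shrunken point.\<close>
    define L where "L = Max {K, N / b1 ^ n, N / b2 ^ n}"
    have L: "K \<le> L" "N / b1 ^ n \<le> L" "N / b2 ^ n \<le> L" by (simp_all add: L_def)
    have "T (b1 ^ Suc n * x) (b2 ^ Suc n * y) \<le> D ^ Suc n * T x y" if "L \<le> x" "L \<le> y" for x y
    proof -
      have "N / b1 ^ n \<le> x" "N / b2 ^ n \<le> y" using L that by linarith+
      then have "N \<le> b1 ^ n * x" "N \<le> b2 ^ n * y"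
        using b1(1) b2(1) by (simp_all add: divide_le_eq mult.commute)
      then have "T (b1 * (b1 ^ n * x)) (b2 * (b2 ^ n * y)) \<le> D * T (b1 ^ n * x) (b2 ^ n * y)"
        by (rule stepD)
      also have "\<dots> \<le> D * (D ^ n * T x y)"
        using K[of x y] L(1) that D by (intro mult_left_mono) auto
      finally show ?thesis by (simp add: mult.assoc)
    qed
    then show ?case by blast
  qed
  obtain n1 n2 where n: "b1 ^ n1 < a" "b2 ^ n2 < a"
    using real_arch_pow_inv[OF a b1(2)] real_arch_pow_inv[OF a b2(2)] by blast
  define n where "n = max n1 n2"
  have "b1 ^ n \<le> b1 ^ n1" "b2 ^ n \<le> b2 ^ n2"
    using b1 b2 by (auto simp: n_def intro!: power_decreasing)
  with n have ba: "b1 ^ n \<le> a" "b2 ^ n \<le> a" by linarith+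
  obtain K where K: "\<And>x y. K \<le> x \<Longrightarrow> K \<le> y \<Longrightarrow>
      T (b1 ^ n * x) (b2 ^ n * y) \<le> D ^ n * T x y" using iter[of n] by blast
  \<comment> \<open>Non-negative arguments turn \<open>b\<^sub>i ^ n \<le> a\<close> into an order between the arguments of \<open>T\<close>.\<close>
  have "T (a * x) (a * y) \<le> D ^ n * T x y" if "max K 0 \<le> x" "max K 0 \<le> y" for x y
  proof -
    have "T (a * x) (a * y) \<le> T (b1 ^ n * x) (b2 ^ n * y)"
      using ba that by (intro anti mult_right_mono) auto
    also have "\<dots> \<le> D ^ n * T x y" using K that by auto
    finally show ?thesis .
  qed
  then show "\<exists>C N. \<forall>x\<ge>N. \<forall>y\<ge>N. T (a * x) (a * y) \<le> C * T x y" by blast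
qed

text \<open>The abstract form of the pigeonhole argument: the loss of a factor \<open>1/2\<close> in the upper
  bound is absorbed by dilation boundedness of each \<open>T i\<close> for the factor \<open>a/2\<close>.\<close>

lemma dilation_bounded_sandwich:
  fixes S :: "real \<Rightarrow> real \<Rightarrow> real"
  assumes I: "finite I"
    and T: "\<And>i. i \<in> I \<Longrightarrow> dilation_bounded (T i)"
    and nonneg: "\<And>i x y. i \<in> I \<Longrightarrow> 0 \<le> T i x y"
    and upper: "\<And>x y. S x y \<le> (\<Sum>i\<in>I. T i (x / 2) (y / 2))"
    and lower: "\<And>i x y. i \<in> I \<Longrightarrow> T i x y \<le> S x y"
  shows "dilation_bounded S"
  unfolding dilation_bounded_def
proof (intro allI impI)
  fix a :: real
  assume "0 < a"
  then have "\<forall>i\<in>I. \<exists>C N. \<forall>x\<ge>N. \<forall>y\<ge>N. T i (a / 2 * x) (a / 2 * y) \<le> C * T i x y"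
    using T unfolding dilation_bounded_def by (meson half_gt_zero)
  then obtain C N where CN: "\<And>i x y. i \<in> I \<Longrightarrow> N i \<le> x \<Longrightarrow> N i \<le> y \<Longrightarrow>
      T i (a / 2 * x) (a / 2 * y) \<le> C i * T i x y" by metis
  define K where "K = Max (insert 0 (N ` I))"
  have K: "N i \<le> K" if "i \<in> I" for i using I that by (simp add: K_def)
  \<comment> \<open>Absolute values make \<open>T i \<le> S\<close> usable even if some \<open>C i\<close> is negative.\<close>
  have "S (a * x) (a * y) \<le> (\<Sum>i\<in>I. \<bar>C i\<bar>) * S x y" if "K \<le> x" "K \<le> y" for x y
  proof -
    have "S (a * x) (a * y) \<le> (\<Sum>i\<in>I. T i (a / 2 * x) (a / 2 * y))"
      using upper[of "a * x" "a * y"] by simp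
    also have "\<dots> \<le> (\<Sum>i\<in>I. \<bar>C i\<bar> * S x y)"
    proof (rule sum_mono)
      fix i assume i: "i \<in> I"
      have "T i (a / 2 * x) (a / 2 * y) \<le> C i * T i x y"
        using CN[OF i] K[OF i] that by auto
      also have "\<dots> \<le> \<bar>C i\<bar> * S x y"
        using nonneg[OF i] lower[OF i] by (intro mult_mono) auto
      finally show "T i (a / 2 * x) (a / 2 * y) \<le> \<bar>C i\<bar> * S x y" .
    qed
    finally show ?thesis by (simp add: sum_distrib_right)
  qed
  then show "\<exists>C N. \<forall>x\<ge>N. \<forall>y\<ge>N. S (a * x) (a * y) \<le> C * S x y" by blast
qed

section \<open>Limits superior of quotients as eventual bounds\<close>

text \<open>Positivity of the denominator is what allows the quotient bound to be multiplied out.\<close>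

lemma Limsup_quotient_finite_iff:
  fixes f g :: "'b \<Rightarrow> real"
  assumes pos: "eventually (\<lambda>z. 0 < g z) F"
  shows "Limsup F (\<lambda>z. ereal (f z / g z)) < \<infinity> \<longleftrightarrow>
    (\<exists>C. eventually (\<lambda>z. f z \<le> C * g z) F)" (is "?L \<longleftrightarrow> ?R")
proof
  assume ?L
  then obtain n :: nat where "Limsup F (\<lambda>z. ereal (f z / g z)) < ereal (real n)"
    using less_PInf_Ex_of_nat by auto
  then have "eventually (\<lambda>z. ereal (f z / g z) < ereal (real n)) F"
    by (rule Limsup_lessD)
  with pos have "eventually (\<lambda>z. f z \<le> real n * g z) F"
    by eventually_elim (simp add: divide_less_eq)
  then show ?R by blast
next
  assume ?R
  then obtain C where "eventually (\<lambda>z. f z \<le> C * g z) F" by blast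
  with pos have "eventually (\<lambda>z. ereal (f z / g z) \<le> ereal C) F"
    by eventually_elim (simp add: divide_le_eq)
  then have "Limsup F (\<lambda>z. ereal (f z / g z)) \<le> ereal C" by (rule Limsup_bounded)
  also have "ereal C < \<infinity>" by simp
  finally show ?L .
qed

lemma eventually_min_at_top:
  "eventually P min_at_top \<longleftrightarrow> (\<exists>N. \<forall>x\<ge>N. \<forall>y\<ge>N. P (x, y))"
proof -
  have "eventually P min_at_top \<longleftrightarrow> (\<exists>N. \<forall>z. N \<le> min (fst z) (snd z) \<longrightarrow> P z)"
  proof
    assume "eventually P min_at_top"
    then obtain Q and N :: real
      where "\<And>z. Q (min (fst z) (snd z)) \<Longrightarrow> P z" "\<And>n. N \<le> n \<Longrightarrow> Q n"
      unfolding min_at_top_def eventually_filtercomap eventually_at_top_linorder case_prod_beta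
      by blast
    then show "\<exists>N. \<forall>z. N \<le> min (fst z) (snd z) \<longrightarrow> P z" by blast
  next
    assume "\<exists>N. \<forall>z. N \<le> min (fst z) (snd z) \<longrightarrow> P z"
    then obtain N where "\<And>z. N \<le> min (fst z) (snd z) \<Longrightarrow> P z" by blast
    then show "eventually P min_at_top"
      unfolding min_at_top_def eventually_filtercomap eventually_at_top_linorder case_prod_beta
      by (intro exI[of _ "\<lambda>n. N \<le> n"]) blast
  qed
  then show ?thesis by auto
qed

section \<open>The two classes in terms of dilation boundedness\<close>

context prob_space
begin

lemma tail_distr:
  assumes X: "X \<in> borel_measurable M"
  shows "tail (distr M borel X) x = prob {\<omega> \<in> space M. X \<omega> > x}"
proof -
  have "tail (distr M borel X) x = 1 - prob {\<omega> \<in> space M. X \<omega> \<le> x}"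
    using X by (auto simp: tail_def cdf_def measure_distr vimage_def intro!: arg_cong[where f=prob])
  also have "\<dots> = prob {\<omega> \<in> space M. \<not> X \<omega> \<le> x}"
    using X by (subst prob_neg) auto
  finally show ?thesis by (simp add: not_le)
qed

lemma tail_distr_antimono:
  assumes "X \<in> borel_measurable M" "x \<le> x'"
  shows "tail (distr M borel X) x' \<le> tail (distr M borel X) x"
  using assms by (auto simp: tail_distr intro!: finite_measure_mono)

lemma joint_tail_antimono:
  assumes "X \<in> borel_measurable M" "Y \<in> borel_measurable M" "x \<le> x'" "y \<le> y'"
  shows "joint_tail M X Y x' y' \<le> joint_tail M X Y x y"
  using assms by (auto simp: joint_tail_def intro!: finite_measure_mono)

text \<open>Both equivalences below rest on \<open>dilation_bounded_iterate\<close>: the classes ask for one pair of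
  factors in \<open>(0, 1)\<close>, dilation boundedness for every common factor. In the converse direction
  \<open>1 / 2\<close> is an arbitrary choice.\<close>

lemma class_D_distr_iff:
  assumes X: "X \<in> borel_measurable M"
    and pos: "\<And>x. 0 \<le> x \<Longrightarrow> 0 < tail (distr M borel X) x"
  shows "distr M borel X \<in> class_D \<longleftrightarrow> dilation_bounded (\<lambda>x y. tail (distr M borel X) x)"
proof -
  let ?t = "tail (distr M borel X)"
  have rd: "real_distribution (distr M borel X)"
    using X by (rule real_distribution_distr)
  have ev: "eventually (\<lambda>x. 0 < ?t x) at_top"
    using eventually_ge_at_top[of 0] by eventually_elim (rule pos)
  have D: "distr M borel X \<in> class_D \<longleftrightarrow>
      (\<exists>b\<in>{0<..<1}. \<exists>C N. \<forall>x\<ge>N. ?t (b * x) \<le> C * ?t x)"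
    unfolding class_D_def mem_Collect_eq Limsup_quotient_finite_iff[OF ev]
      eventually_at_top_linorder using rd pos by blast
  show ?thesis
  proof
    assume "distr M borel X \<in> class_D"
    then obtain b C N where b: "0 < b" "b < 1"
      and *: "\<And>x. N \<le> x \<Longrightarrow> ?t (b * x) \<le> C * ?t x"
      unfolding D Bex_def greaterThanLessThan_iff by blast
    show "dilation_bounded (\<lambda>x y. ?t x)"
      by (rule dilation_bounded_iterate[of _ b b N C])
        (auto simp: * b X tail_distr_antimono, simp add: tail_distr X)
  next
    assume "dilation_bounded (\<lambda>x y. ?t x)"
    then obtain C N where "\<forall>x\<ge>N. \<forall>y\<ge>(N::real). ?t (1 / 2 * x) \<le> C * ?t x"
      unfolding dilation_bounded_def by (meson half_gt_zero zero_less_one)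
    then show "distr M borel X \<in> class_D"
      unfolding D by (intro bexI[of _ "1 / 2"] exI[of _ C] exI[of _ N]) auto
  qed
qed

lemma class_D2_iff:
  assumes X: "X \<in> borel_measurable M" and Y: "Y \<in> borel_measurable M"
    and D: "distr M borel X \<in> class_D" "distr M borel Y \<in> class_D"
    and pos: "\<And>x y. 0 \<le> x \<Longrightarrow> 0 \<le> y \<Longrightarrow> 0 < joint_tail M X Y x y"
  shows "(X, Y) \<in> class_D2 M \<longleftrightarrow> dilation_bounded (joint_tail M X Y)"
proof -
  let ?J = "joint_tail M X Y"
  have ev: "eventually (\<lambda>z. 0 < ?J (fst z) (snd z)) min_at_top"
    unfolding eventually_min_at_top using pos by auto
  have D2: "(X, Y) \<in> class_D2 M \<longleftrightarrow> (\<exists>b1\<in>{0<..<1}. \<exists>b2\<in>{0<..<1}. \<exists>C N.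
      \<forall>x\<ge>N. \<forall>y\<ge>N. ?J (b1 * x) (b2 * y) \<le> C * ?J x y)"
    unfolding class_D2_def mem_Collect_eq case_prod_beta fst_conv snd_conv
      Limsup_quotient_finite_iff[OF ev] eventually_min_at_top using X Y D pos by blast
  show ?thesis
  proof
    assume "(X, Y) \<in> class_D2 M"
    then obtain b1 b2 C N where b: "0 < b1" "b1 < 1" "0 < b2" "b2 < 1"
      and *: "\<And>x y. N \<le> x \<Longrightarrow> N \<le> y \<Longrightarrow> ?J (b1 * x) (b2 * y) \<le> C * ?J x y"
      unfolding D2 Bex_def greaterThanLessThan_iff by blast
    show "dilation_bounded ?J"
      by (rule dilation_bounded_iterate[of _ b1 b2 N C])
        (auto simp: * b X Y joint_tail_antimono, simp add: joint_tail_def)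
  next
    assume "dilation_bounded ?J"
    then obtain C N where "\<forall>x\<ge>N. \<forall>y\<ge>N. ?J (1 / 2 * x) (1 / 2 * y) \<le> C * ?J x y"
      unfolding dilation_bounded_def by (meson half_gt_zero zero_less_one)
    then show "(X, Y) \<in> class_D2 M"
      unfolding D2
      by (intro bexI[of _ "1 / 2"] exI[of _ C] exI[of _ N]) auto
  qed
qed

section \<open>Tails of sums\<close>

text \<open>If a sum exceeds \<open>x\<close>, its larger summand exceeds \<open>x / 2\<close>, and the union bound applies.
  Summing over sets of functions is harmless when the two summands
  coincide, since the cover then simply has fewer members.\<close>

lemma tail_sum_upper:
  assumes "X1 \<in> borel_measurable M" "X2 \<in> borel_measurable M"
  shows "tail (distr M borel (\<lambda>\<omega>. X1 \<omega> + X2 \<omega>)) x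
    \<le> (\<Sum>X\<in>{X1, X2}. tail (distr M borel X) (x / 2))"
proof -
  have meas [measurable]: "X \<in> borel_measurable M" if "X \<in> {X1, X2}" for X
    using assms that by auto
  have "prob {\<omega> \<in> space M. X1 \<omega> + X2 \<omega> > x}
      \<le> prob (\<Union>X\<in>{X1, X2}. {\<omega> \<in> space M. X \<omega> > x / 2})"
    using assms by (intro finite_measure_mono) auto
  also have "\<dots> \<le> (\<Sum>X\<in>{X1, X2}. prob {\<omega> \<in> space M. X \<omega> > x / 2})"
    using assms by (intro finite_measure_subadditive_finite) auto
  also have "\<dots> = (\<Sum>X\<in>{X1, X2}. tail (distr M borel X) (x / 2))"
    by (intro sum.cong refl tail_distr[symmetric] meas)
  finally show ?thesis using assms by (simp add: tail_distr)
qed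

lemma joint_tail_sum_upper:
  assumes "X1 \<in> borel_measurable M" "X2 \<in> borel_measurable M"
    and "Y1 \<in> borel_measurable M" "Y2 \<in> borel_measurable M"
  shows "joint_tail M (\<lambda>\<omega>. X1 \<omega> + X2 \<omega>) (\<lambda>\<omega>. Y1 \<omega> + Y2 \<omega>) x y
    \<le> (\<Sum>p\<in>{X1, X2} \<times> {Y1, Y2}. joint_tail M (fst p) (snd p) (x / 2) (y / 2))"
proof -
  let ?A = "\<lambda>p. {\<omega> \<in> space M. fst p \<omega> > x / 2 \<and> snd p \<omega> > y / 2}"
  have meas: "?A p \<in> events" if "p \<in> {X1, X2} \<times> {Y1, Y2}" for p
    using assms that by auto
  have "prob {\<omega> \<in> space M. X1 \<omega> + X2 \<omega> > x \<and> Y1 \<omega> + Y2 \<omega> > y}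
      \<le> prob (\<Union>p\<in>{X1, X2} \<times> {Y1, Y2}. ?A p)"
  proof (rule finite_measure_mono)
    show "{\<omega> \<in> space M. X1 \<omega> + X2 \<omega> > x \<and> Y1 \<omega> + Y2 \<omega> > y}
      \<subseteq> (\<Union>p\<in>{X1, X2} \<times> {Y1, Y2}. ?A p)"
      by auto
    show "(\<Union>p\<in>{X1, X2} \<times> {Y1, Y2}. ?A p) \<in> events"
      by (intro sets.finite_UN meas) auto
  qed
  also have "\<dots> \<le> (\<Sum>p\<in>{X1, X2} \<times> {Y1, Y2}. prob (?A p))"
    using meas by (intro finite_measure_subadditive_finite) auto
  finally show ?thesis by (simp only: joint_tail_def)
qed

lemma tail_sum_lower:
  assumes [measurable]: "X1 \<in> borel_measurable M" "X2 \<in> borel_measurable M"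
    and nonneg: "AE \<omega> in M. 0 \<le> X1 \<omega>" "AE \<omega> in M. 0 \<le> X2 \<omega>"
    and X: "X \<in> {X1, X2}"
  shows "tail (distr M borel X) x \<le> tail (distr M borel (\<lambda>\<omega>. X1 \<omega> + X2 \<omega>)) x"
proof -
  have [measurable]: "X \<in> borel_measurable M" using X assms(1,2) by auto
  have "AE \<omega> in M. X \<omega> \<le> X1 \<omega> + X2 \<omega>"
    using nonneg by eventually_elim (use X in auto)
  then have "prob {\<omega> \<in> space M. X \<omega> > x} \<le> prob {\<omega> \<in> space M. X1 \<omega> + X2 \<omega> > x}"
    by (intro finite_measure_mono_AE) auto
  then show ?thesis by (simp add: tail_distr)
qed

lemma joint_tail_sum_lower:
  assumes [measurable]: "X1 \<in> borel_measurable M" "X2 \<in> borel_measurable M"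
      "Y1 \<in> borel_measurable M" "Y2 \<in> borel_measurable M"
    and nonneg: "AE \<omega> in M. 0 \<le> X1 \<omega>" "AE \<omega> in M. 0 \<le> X2 \<omega>"
      "AE \<omega> in M. 0 \<le> Y1 \<omega>" "AE \<omega> in M. 0 \<le> Y2 \<omega>"
    and X: "X \<in> {X1, X2}" and Y: "Y \<in> {Y1, Y2}"
  shows "joint_tail M X Y x y \<le> joint_tail M (\<lambda>\<omega>. X1 \<omega> + X2 \<omega>) (\<lambda>\<omega>. Y1 \<omega> + Y2 \<omega>) x y"
proof -
  have "AE \<omega> in M. X \<omega> \<le> X1 \<omega> + X2 \<omega> \<and> Y \<omega> \<le> Y1 \<omega> + Y2 \<omega>"
    using nonneg by eventually_elim (use X Y in auto)
  then show ?thesis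
    unfolding joint_tail_def by (intro finite_measure_mono_AE) auto
qed

text \<open>The one-dimensional counterpart of the main result, needed because membership in
  \<^const>\<open>class_D2\<close> includes a condition on both marginals.\<close>

lemma class_D_sum:
  assumes X: "X1 \<in> borel_measurable M" "X2 \<in> borel_measurable M"
    and nonneg: "AE \<omega> in M. 0 \<le> X1 \<omega>" "AE \<omega> in M. 0 \<le> X2 \<omega>"
    and D: "distr M borel X1 \<in> class_D" "distr M borel X2 \<in> class_D"
  shows "distr M borel (\<lambda>\<omega>. X1 \<omega> + X2 \<omega>) \<in> class_D"
proof -
  let ?t = "\<lambda>X. tail (distr M borel X)"
  have meas: "X \<in> borel_measurable M" if "X \<in> {X1, X2}" for X using X that by auto
  have pos: "0 < ?t X x" if "X \<in> {X1, X2}" "0 \<le> x" for X x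
    using D that by (auto simp: class_D_def)
  have lower: "?t X x \<le> ?t (\<lambda>\<omega>. X1 \<omega> + X2 \<omega>) x" if "X \<in> {X1, X2}" for X x
    using tail_sum_lower[OF X nonneg that] .
  have pos_sum: "0 < ?t (\<lambda>\<omega>. X1 \<omega> + X2 \<omega>) x" if "0 \<le> x" for x
    using pos[of X1 x] lower[of X1 x] that by simp
  have "dilation_bounded (\<lambda>x y. ?t (\<lambda>\<omega>. X1 \<omega> + X2 \<omega>) x)"
  proof (rule dilation_bounded_sandwich)
    show "finite {X1, X2}" by simp
    show "dilation_bounded (\<lambda>x y. ?t X x)" if "X \<in> {X1, X2}" for X
      using class_D_distr_iff[OF meas pos] that D by auto
    show "0 \<le> ?t X x" if "X \<in> {X1, X2}" for X x
      using meas[OF that] by (simp add: tail_distr)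
    show "?t (\<lambda>\<omega>. X1 \<omega> + X2 \<omega>) x \<le> (\<Sum>X\<in>{X1, X2}. ?t X (x / 2))" for x
      using X by (rule tail_sum_upper)
    show "?t X x \<le> ?t (\<lambda>\<omega>. X1 \<omega> + X2 \<omega>) x" if "X \<in> {X1, X2}" for X x
      using lower[OF that] .
  qed
  then show ?thesis
    using class_D_distr_iff[OF _ pos_sum] X by auto
qed

lemma class_D2_sum:
  assumes X: "X1 \<in> borel_measurable M" "X2 \<in> borel_measurable M"
    and Y: "Y1 \<in> borel_measurable M" "Y2 \<in> borel_measurable M"
    and nonneg: "AE \<omega> in M. 0 \<le> X1 \<omega>" "AE \<omega> in M. 0 \<le> X2 \<omega>"
      "AE \<omega> in M. 0 \<le> Y1 \<omega>" "AE \<omega> in M. 0 \<le> Y2 \<omega>"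
    and D2: "\<And>X Y. X \<in> {X1, X2} \<Longrightarrow> Y \<in> {Y1, Y2} \<Longrightarrow> (X, Y) \<in> class_D2 M"
  shows "(\<lambda>\<omega>. X1 \<omega> + X2 \<omega>, \<lambda>\<omega>. Y1 \<omega> + Y2 \<omega>) \<in> class_D2 M"
proof -
  let ?J = "joint_tail M"
  let ?X = "\<lambda>\<omega>. X1 \<omega> + X2 \<omega>" and ?Y = "\<lambda>\<omega>. Y1 \<omega> + Y2 \<omega>"
  have D: "distr M borel X \<in> class_D" "distr M borel Y \<in> class_D"
    and pos: "\<And>x y. 0 \<le> x \<Longrightarrow> 0 \<le> y \<Longrightarrow> 0 < ?J X Y x y"
    and meas: "X \<in> borel_measurable M" "Y \<in> borel_measurable M"
    if "X \<in> {X1, X2}" "Y \<in> {Y1, Y2}" for X Y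
    using D2[OF that] by (auto simp: class_D2_def)
  have lower: "?J X Y x y \<le> ?J ?X ?Y x y" if "X \<in> {X1, X2}" "Y \<in> {Y1, Y2}" for X Y x y
    using joint_tail_sum_lower[OF X Y nonneg that] .
  have pos_sum: "0 < ?J ?X ?Y x y" if "0 \<le> x" "0 \<le> y" for x y
    using pos[of X1 Y1 x y] lower[of X1 Y1 x y] that by simp
  have D_sum: "distr M borel ?X \<in> class_D" "distr M borel ?Y \<in> class_D"
    using D by (auto intro!: class_D_sum X Y nonneg)
  have "dilation_bounded (?J ?X ?Y)"
  proof (rule dilation_bounded_sandwich)
    show "finite ({X1, X2} \<times> {Y1, Y2})" by simp
    show "dilation_bounded (?J (fst p) (snd p))" if "p \<in> {X1, X2} \<times> {Y1, Y2}" for p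
    proof -
      have p: "fst p \<in> {X1, X2}" "snd p \<in> {Y1, Y2}" using that by auto
      show ?thesis
        using class_D2_iff[OF meas[OF p] D[OF p] pos[OF p]] D2[OF p] by simp
    qed
    show "0 \<le> ?J (fst p) (snd p) x y" for p :: "('a \<Rightarrow> real) \<times> ('a \<Rightarrow> real)" and x y
      by (simp add: joint_tail_def)
    show "?J ?X ?Y x y \<le> (\<Sum>p\<in>{X1, X2} \<times> {Y1, Y2}. ?J (fst p) (snd p) (x / 2) (y / 2))" for x y
      using X Y by (rule joint_tail_sum_upper)
    show "?J (fst p) (snd p) x y \<le> ?J ?X ?Y x y" if "p \<in> {X1, X2} \<times> {Y1, Y2}" for p x y
      using that by (intro lower) auto
  qed
  then show ?thesis
    using class_D2_iff[OF _ _ D_sum pos_sum] X Y by auto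
qed

end

theorem theorem3p1:
  fixes M :: "'a measure"
    and X1 X2 Y1 Y2 :: "'a \<Rightarrow> real"
    and F1 F2 G1 G2 :: "real measure"
  assumes "prob_space M"
    and "X1 \<in> borel_measurable M" and "X2 \<in> borel_measurable M"
    and "Y1 \<in> borel_measurable M" and "Y2 \<in> borel_measurable M"
    and "AE \<omega> in M. X1 \<omega> \<ge> 0" and "AE \<omega> in M. X2 \<omega> \<ge> 0"
    and "AE \<omega> in M. Y1 \<omega> \<ge> 0" and "AE \<omega> in M. Y2 \<omega> \<ge> 0"
    and "distr M borel X1 = F1" and "distr M borel X2 = F2"
    and "distr M borel Y1 = G1" and "distr M borel Y2 = G2"
    and "F1 \<in> class_D" and "F2 \<in> class_D" and "G1 \<in> class_D" and "G2 \<in> class_D"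
    and "\<forall>X\<in>{X1, X2}. \<forall>Y\<in>{Y1, Y2}. (X, Y) \<in> class_D2 M"
  shows "(\<lambda>\<omega>. X1 \<omega> + X2 \<omega>, \<lambda>\<omega>. Y1 \<omega> + Y2 \<omega>) \<in> class_D2 M"
proof -
  interpret prob_space M by fact
  show ?thesis
    by (rule class_D2_sum) (use assms in auto)
qed

end
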